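(* Let $X$ be a real random variable, let $m\in\{0,1,2,\ldots\}$, and let $P:\mathbf{R}\to\mathbf{R}$ be a measurable function with exactly $m$ sign changes, positive on its rightmost interval, and such that $$\frac{1}{m!}\,E\big[X^kP(X)\big]=\alpha\,\delta_{k,m},\qquad k=0,\ldots,m,$$ with $\alpha>0$. Then there exists a unique distribution for a random variable $X^{(P)}$ such that $$E\,P(X)F(X)=\alpha\,E\,F^{(m)}(X^{(P)})\qquad\text{for all } F\in\mathcal{F}^m(P).$$
   Context: $\delta_{k,m}$ is the Kronecker delta and $F^{(m)}$ is the $m$-th derivative of $F$ (with $F^{(0)}=F$). A measurable function $P$ on $\mathbf{R}$ is called positive on an interval $I$ if $P(x)\ge 0$ for all $x\in I$ with strict inequality for at least one $x\in I$; negative on $I$ is defined similarly. $P$ has exactly $m$ sign changes if $\mathbf{R}$ can be partitioned into $m+1$ disjoint subintervals with non-empty interior such that $P$ alternates sign on successive intervals, where $P$ being positive on an interval means $P\ge 0$ throughout it with $P>0$ for at least one point of it, and $P$ being negative on an interval means $P\le 0$ throughout it with $P<0$ for at least one point of it; the "rightmost interval" is the last interval of such a partition. $\mathcal{C}^m$ denotes the collection of functions $F:\mathbf{R}\to\mathbf{R}$ whose $m$-th derivative exists and is measurable on $\mathbf{R}$, and, for the given $X$, $\mathcal{F}^m(P)=\{F\in\mathcal{C}^m: E|P(X)F(X)|<\infty\}$.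
   Formalization: The identity is asserted for those F in F^m(P) for which E F^(m)(X^(P)) is defined (possibly infinite), and is then proved finite and equal; for some F in F^m(P) that expectation does not exist, e.g. m=1, P(x)=x, X=±1, F(x)=x+x² sin(1/x²). *)

theory Defs
  imports "HOL-Probability.Probability"
begin

definition positive_on :: "(real \<Rightarrow> real) \<Rightarrow> real set \<Rightarrow> bool" where
  "positive_on P I \<longleftrightarrow> (\<forall>x\<in>I. 0 \<le> P x) \<and> (\<exists>x\<in>I. 0 < P x)"

definition negative_on :: "(real \<Rightarrow> real) \<Rightarrow> real set \<Rightarrow> bool" where
  "negative_on P I \<longleftrightarrow> (\<forall>x\<in>I. P x \<le> 0) \<and> (\<exists>x\<in>I. P x < 0)"

text \<open>The intervals of the partition are \<open>I 0, \<dots>, I m\<close>, listed from left to right; \<open>I m\<close> is the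
  rightmost one. The order condition also makes them disjoint.\<close>

definition ordered_interval_partition :: "nat \<Rightarrow> (nat \<Rightarrow> real set) \<Rightarrow> bool" where
  "ordered_interval_partition m I \<longleftrightarrow>
     (\<forall>i\<le>m. is_interval (I i) \<and> interior (I i) \<noteq> {}) \<and>
     (\<Union>i\<le>m. I i) = UNIV \<and>
     (\<forall>i j. i < j \<and> j \<le> m \<longrightarrow> (\<forall>x\<in>I i. \<forall>y\<in>I j. x < y))"

text \<open>\<open>P\<close> has exactly \<open>m\<close> sign changes iff \<open>sign_change_partition m P I\<close> for some \<open>I\<close>. Such an
  \<open>m\<close> is unique, because \<open>P\<close> takes a value of strict sign on each interval.\<close>

definition sign_change_partition ::
    "nat \<Rightarrow> (real \<Rightarrow> real) \<Rightarrow> (nat \<Rightarrow> real set) \<Rightarrow> bool" where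
  "sign_change_partition m P I \<longleftrightarrow>
     ordered_interval_partition m I \<and>
     (\<forall>i\<le>m. positive_on P (I i) \<or> negative_on P (I i)) \<and>
     (\<forall>i<m. positive_on P (I i) \<longleftrightarrow> negative_on P (I (Suc i)))"

text \<open>The class \<open>C\<^sup>m\<close>. As \<open>deriv\<close> is total, existence of the \<open>m\<close>-th derivative is expressed by
  differentiability of all derivatives of lower order.\<close>

definition diff_class :: "nat \<Rightarrow> (real \<Rightarrow> real) set" where
  "diff_class m = {F. (\<forall>k<m. \<forall>x. ((deriv ^^ k) F) differentiable (at x)) \<and>
                      (deriv ^^ m) F \<in> borel_measurable borel}"

definition test_class ::
    "'a measure \<Rightarrow> ('a \<Rightarrow> real) \<Rightarrow> nat \<Rightarrow> (real \<Rightarrow> real) \<Rightarrow> (real \<Rightarrow> real) set" where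
  "test_class M X m P =
     {F \<in> diff_class m. integrable M (\<lambda>\<omega>. \<bar>P (X \<omega>) * F (X \<omega>)\<bar>)}"

text \<open>The expectation of \<open>f\<close> under \<open>\<nu>\<close> is defined, possibly as \<open>\<infinity>\<close> or \<open>-\<infinity>\<close>: the positive or
  the negative part has finite integral. Note that \<open>ennreal\<close> sends negative numbers to \<open>0\<close>.\<close>

definition expectation_exists :: "real measure \<Rightarrow> (real \<Rightarrow> real) \<Rightarrow> bool" where
  "expectation_exists \<nu> f \<longleftrightarrow>
     f \<in> borel_measurable \<nu> \<and>
     ((\<integral>\<^sup>+x. ennreal (f x) \<partial>\<nu>) < \<infinity> \<or> (\<integral>\<^sup>+x. ennreal (- f x) \<partial>\<nu>) < \<infinity>)"

text \<open>\<open>\<nu>\<close> satisfies \<open>E P(X) F(X) = \<alpha> E F\<^sup>(\<^sup>m\<^sup>)(Y)\<close> for \<open>Y\<close> with law \<open>\<nu>\<close> and all \<open>F\<close> in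
  \<open>test_class M X m P\<close> for which the right-hand side is defined. Membership of \<open>F\<close> in the class
  does not make it defined: for \<open>m = 1\<close>, \<open>P x = x\<close> and \<open>X\<close> uniform on \<open>{-1, 1}\<close>, the law is
  uniform on \<open>[-1, 1]\<close>, and \<open>F x = x + x\<^sup>2 sin (1 / x\<^sup>2)\<close> (with \<open>F 0 = 0\<close>) is in the class but
  both parts of \<open>F'\<close> have infinite integral. When the right-hand side is defined, it is required
  to be finite and equal to the left-hand side.\<close>

definition characterizes ::
    "real measure \<Rightarrow> 'a measure \<Rightarrow> ('a \<Rightarrow> real) \<Rightarrow> nat \<Rightarrow> (real \<Rightarrow> real) \<Rightarrow> real \<Rightarrow> bool" where
  "characterizes \<nu> M X m P \<alpha> \<longleftrightarrow>
     (\<forall>F \<in> test_class M X m P. expectation_exists \<nu> ((deriv ^^ m) F) \<longrightarrow>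
        integrable \<nu> ((deriv ^^ m) F) \<and>
        (\<integral>\<omega>. P (X \<omega>) * F (X \<omega>) \<partial>M) = \<alpha> * (\<integral>x. (deriv ^^ m) F x \<partial>\<nu>))"

end

theory Submission
  imports Defs
begin

text \<open>For \<open>m = 0\<close> the function \<open>P\<close> is nonnegative and the law is the distribution of \<open>X\<close> reweighted by
  \<open>P / \<alpha>\<close>. Now let \<open>m = n + 1\<close>, and let \<open>\<xi> 0 < \<dots> < \<xi> n\<close> be the points where \<open>P\<close> changes sign, so
  that \<open>P x * \<Prod>(x - \<xi> i) \<ge> 0\<close> everywhere (\<open>sign_change_nodes\<close>). Let \<open>L F\<close> be the polynomial of degree
  at most \<open>n\<close> that interpolates \<open>F\<close> at these nodes. The first \<open>m\<close> moments of \<open>P(X)\<close> vanish, so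
  \<open>E P(X) F(X) = E P(X) (F - L F)(X)\<close>. Peano's formula gives
  \<open>n! (F - L F)(x) = \<integral> r(x, t) F\<^sup>(\<^sup>m\<^sup>)(t) dt\<close>, where the kernel \<open>r(x, t)\<close> is the interpolation error
  at \<open>x\<close> of the truncated power \<open>y \<mapsto> (y - t)\<^sub>+\<^sup>n\<close>. Divided by \<open>\<Prod>(x - \<xi> i)\<close> this kernel is a
  nonnegative B-spline, so it has the sign of that product (\<open>peano_kernel_sign\<close>). Therefore \<open>P(x) r(x, t) \<ge> 0\<close> for
  all \<open>x\<close> and \<open>t\<close>, and \<open>t \<mapsto> E P(X) r(X, t) / (\<alpha> n!)\<close> is the density of the required law.

  The delicate point is that \<open>F\<^sup>(\<^sup>m\<^sup>)\<close> is merely an everywhere existing derivative and may fail to be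
  locally Lebesgue integrable. Peano's formula is therefore stated for the Henstock-Kurzweil
  integral, where the fundamental theorem of calculus holds for such derivatives. If one of the two
  parts of \<open>F\<^sup>(\<^sup>m\<^sup>)\<close> is integrable under the law, then, the weights \<open>P(x) r(x, t)\<close> being nonnegative,
  Tonelli's theorem bounds that part for almost every value of \<open>X\<close>; the Henstock-Kurzweil integral
  then controls the other part, and both sides of the identity are finite and equal
  (\<open>law_identity\<close>).

  Uniqueness: shifted cosines, divided by \<open>u\<^sup>m\<close>, are bounded test functions whose \<open>m\<close>-th derivatives
  are again cosines, so the identity determines the characteristic function.\<close>

section \<open>Lagrange interpolation and its error\<close>

definition truncated_power :: "nat \<Rightarrow> real \<Rightarrow> real \<Rightarrow> real" where
  "truncated_power n t x = (if t < x then (x - t) ^ n else 0)"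

definition lagrange_basis :: "(nat \<Rightarrow> real) \<Rightarrow> nat \<Rightarrow> nat \<Rightarrow> real poly" where
  "lagrange_basis \<xi> n i = (\<Prod>j\<in>{..n} - {i}. smult (1 / (\<xi> i - \<xi> j)) [:- \<xi> j, 1:])"

definition lagrange_interpolant :: "(nat \<Rightarrow> real) \<Rightarrow> nat \<Rightarrow> (real \<Rightarrow> real) \<Rightarrow> real poly" where
  "lagrange_interpolant \<xi> n f = (\<Sum>i\<le>n. smult (f (\<xi> i)) (lagrange_basis \<xi> n i))"

definition interpolation_error :: "(nat \<Rightarrow> real) \<Rightarrow> nat \<Rightarrow> (real \<Rightarrow> real) \<Rightarrow> real \<Rightarrow> real" where
  "interpolation_error \<xi> n f x = f x - poly (lagrange_interpolant \<xi> n f) x"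

definition peano_kernel :: "(nat \<Rightarrow> real) \<Rightarrow> nat \<Rightarrow> real \<Rightarrow> real \<Rightarrow> real" where
  "peano_kernel \<xi> n x t = interpolation_error \<xi> n (truncated_power n t) x"

lemma poly_lagrange_interpolant:
  "poly (lagrange_interpolant \<xi> n f) x = (\<Sum>i\<le>n. f (\<xi> i) * poly (lagrange_basis \<xi> n i) x)"
  by (simp add: lagrange_interpolant_def poly_sum)

lemma degree_lagrange_basis:
  assumes "i \<le> n"
  shows "degree (lagrange_basis \<xi> n i) \<le> n"
proof -
  have "degree (lagrange_basis \<xi> n i)
      \<le> sum (degree \<circ> (\<lambda>j. smult (1 / (\<xi> i - \<xi> j)) [:- \<xi> j, 1:])) ({..n} - {i})"
    unfolding lagrange_basis_def by (intro degree_prod_sum_le) simp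
  also have "\<dots> \<le> (\<Sum>j\<in>{..n} - {i}. 1)"
    by (intro sum_mono) simp
  also have "\<dots> = n"
    using assms by simp
  finally show ?thesis .
qed

lemma degree_lagrange_interpolant: "degree (lagrange_interpolant \<xi> n f) \<le> n"
  unfolding lagrange_interpolant_def
  by (intro degree_sum_le) (use degree_lagrange_basis in \<open>auto simp: degree_smult_eq\<close>)

lemma poly_lagrange_basis_node:
  assumes "inj_on \<xi> {..n}" "i \<le> n" "k \<le> n"
  shows "poly (lagrange_basis \<xi> n i) (\<xi> k) = (if i = k then 1 else 0)"
  using assms
  by (auto simp: lagrange_basis_def poly_prod prod_zero_iff inj_on_def diff_divide_distrib[symmetric]
      intro!: prod.neutral split: if_splits)

lemma lagrange_interpolant_node:
  assumes "inj_on \<xi> {..n}" "k \<le> n"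
  shows "poly (lagrange_interpolant \<xi> n f) (\<xi> k) = f (\<xi> k)"
proof -
  have "poly (lagrange_interpolant \<xi> n f) (\<xi> k) = (\<Sum>i\<le>n. f (\<xi> i) * (if i = k then 1 else 0))"
    unfolding poly_lagrange_interpolant
    by (intro sum.cong) (auto simp: poly_lagrange_basis_node assms)
  also have "\<dots> = f (\<xi> k)"
    using assms by (simp add: sum.delta' if_distrib cong: if_cong)
  finally show ?thesis .
qed

lemma lagrange_interpolant_unique:
  assumes "inj_on \<xi> {..n}" "degree q \<le> n" "\<And>i. i \<le> n \<Longrightarrow> poly q (\<xi> i) = f (\<xi> i)"
  shows "lagrange_interpolant \<xi> n f = q"
proof (rule poly_eqI_degree)
  show "poly (lagrange_interpolant \<xi> n f) x = poly q x" if "x \<in> \<xi> ` {..n}" for x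
    using that assms by (auto simp: lagrange_interpolant_node)
  show "degree (lagrange_interpolant \<xi> n f) < card (\<xi> ` {..n})"
    using degree_lagrange_interpolant[of \<xi> n f] assms(1) by (simp add: card_image)
  show "degree q < card (\<xi> ` {..n})"
    using assms(1,2) by (simp add: card_image)
qed

lemma interpolation_error_poly:
  assumes "inj_on \<xi> {..n}" "degree q \<le> n"
  shows "interpolation_error \<xi> n (poly q) x = 0"
  using lagrange_interpolant_unique[OF assms, of "poly q"] by (simp add: interpolation_error_def)

lemma interpolation_error_node:
  assumes "inj_on \<xi> {..n}" "k \<le> n"
  shows "interpolation_error \<xi> n f (\<xi> k) = 0"
  by (simp add: interpolation_error_def lagrange_interpolant_node assms)

lemma interpolation_error_sum:
  "interpolation_error \<xi> n f x = f x - (\<Sum>i\<le>n. f (\<xi> i) * poly (lagrange_basis \<xi> n i) x)"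
  by (simp add: interpolation_error_def poly_lagrange_interpolant)

lemma interpolation_error_cong:
  assumes "f x = g x" "\<And>i. i \<le> n \<Longrightarrow> f (\<xi> i) = g (\<xi> i)"
  shows "interpolation_error \<xi> n f x = interpolation_error \<xi> n g x"
  using assms by (simp add: interpolation_error_sum)

lemma interpolation_error_diff:
  "interpolation_error \<xi> n (\<lambda>y. f y - g y) x
    = interpolation_error \<xi> n f x - interpolation_error \<xi> n g x"
  by (simp add: interpolation_error_sum left_diff_distrib sum_subtractf)

lemma interpolation_error_scale:
  "interpolation_error \<xi> n (\<lambda>y. c * f y) x = c * interpolation_error \<xi> n f x"
  by (simp add: interpolation_error_sum right_diff_distrib sum_distrib_left mult.assoc)

lemma degree_linear_power: "degree ([:-t, 1:] ^ n :: real poly) \<le> n"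
  using degree_power_le[of "[:-t, 1:] :: real poly" n] by simp

section \<open>The sign of the Peano kernel\<close>

text \<open>This is the nonnegativity of B-splines, by their two-term recurrence. If \<open>t\<close> is to the right of
  all nodes the interpolant is \<open>0\<close>, if it is to the left it is \<open>(x - t)\<^sup>n\<close>, and the sign can be read
  off. Otherwise write \<open>t\<close> as the convex combination \<open>\<rho> \<xi>\<^sub>n\<^sub>+\<^sub>1 + \<kappa> \<xi>\<^sub>0\<close>. As
  \<open>(x - t)\<^sub>+\<^sup>n\<^sup>+\<^sup>1 = (\<rho> (x - \<xi>\<^sub>n\<^sub>+\<^sub>1) + \<kappa> (x - \<xi>\<^sub>0)) (x - t)\<^sub>+\<^sup>n\<close>, the interpolant for all nodes is the
  corresponding combination of the one that omits \<open>\<xi>\<^sub>n\<^sub>+\<^sub>1\<close> and the one that omits \<open>\<xi>\<^sub>0\<close>; each of the two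
  errors has the sign of its own node product, and the extra linear factor completes this to the
  product over all nodes.\<close>

lemma truncated_power_interpolant_sign:
  assumes "strict_mono_on {..n} \<xi>"
  shows "\<exists>q. degree q \<le> n \<and> (\<forall>i\<le>n. poly q (\<xi> i) = truncated_power n t (\<xi> i)) \<and>
             (\<forall>x. 0 \<le> (truncated_power n t x - poly q x) * (\<Prod>i\<le>n. x - \<xi> i))"
  using assms
proof (induction n arbitrary: \<xi>)
  case 0
  show ?case
    by (rule exI[of _ "if t < \<xi> 0 then 1 else 0"]) (auto simp: truncated_power_def)
next
  case (Suc n)
  note mono = Suc.prems
  have le: "\<xi> 0 \<le> \<xi> i" "\<xi> i \<le> \<xi> (Suc n)" if "i \<le> Suc n" for i
    using that strict_mono_on_leD[OF mono] by auto
  consider "t < \<xi> 0" | "\<xi> (Suc n) \<le> t" | "\<xi> 0 \<le> t" "t < \<xi> (Suc n)"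
    by linarith
  then show ?case
  proof cases
    case 1
    have "0 \<le> (truncated_power (Suc n) t x - (x - t) ^ Suc n) * (\<Prod>i\<le>Suc n. x - \<xi> i)" for x
    proof (cases "t < x")
      case False
      have "(x - t) ^ Suc n * (\<Prod>i\<le>n. x - \<xi> i) = (\<Prod>i\<le>n. (x - t) * (x - \<xi> i))"
        by (simp add: prod.distrib)
      also have "\<dots> \<ge> 0"
      proof (intro prod_nonneg mult_nonpos_nonpos)
        show "x - \<xi> i \<le> 0" if "i \<in> {..n}" for i
          using that False 1 le(1)[of i] by simp
      qed (use False in simp)
      finally have "0 \<le> (\<xi> (Suc n) - x) * ((x - t) ^ Suc n * (\<Prod>i\<le>n. x - \<xi> i))"
        using False 1 le(1)[of "Suc n"] by (intro mult_nonneg_nonneg[of "\<xi> (Suc n) - x"]) auto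
      then show ?thesis
        using False by (simp add: truncated_power_def algebra_simps)
    qed (simp add: truncated_power_def)
    with 1 le show ?thesis
      by (intro exI[of _ "[:-t, 1:] ^ Suc n"])
        (fastforce simp: truncated_power_def degree_power_eq simp del: power_Suc)
  next
    case 2
    have "0 \<le> truncated_power (Suc n) t x * (\<Prod>i\<le>Suc n. x - \<xi> i)" for x
      using 2 le by (auto simp: truncated_power_def simp del: prod.atMost_Suc
          intro!: mult_nonneg_nonneg prod_nonneg) (smt (verit))
    with 2 le show ?thesis
      by (intro exI[of _ 0]) (fastforce simp: truncated_power_def)
  next
    case 3
    define d where "d = \<xi> (Suc n) - \<xi> 0"
    define \<rho> \<kappa> where "\<rho> = (t - \<xi> 0) / d" and "\<kappa> = (\<xi> (Suc n) - t) / d"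
    have d: "d > 0" using 3 by (simp add: d_def)
    have coeffs: "0 \<le> \<rho>" "0 \<le> \<kappa>" "\<rho> + \<kappa> = 1" "\<rho> * \<xi> (Suc n) + \<kappa> * \<xi> 0 = t"
      using 3 d by (simp_all add: \<rho>_def \<kappa>_def field_simps) (simp_all add: d_def algebra_simps)
    have "strict_mono_on {..n} \<xi>" "strict_mono_on {..n} (\<lambda>i. \<xi> (Suc i))"
      using mono by (auto simp: strict_mono_on_def)
    from Suc.IH[OF this(1)] Suc.IH[OF this(2)] obtain q1 q2 where
      q1: "degree q1 \<le> n" "\<And>i. i \<le> n \<Longrightarrow> poly q1 (\<xi> i) = truncated_power n t (\<xi> i)"
        "\<And>x. 0 \<le> (truncated_power n t x - poly q1 x) * (\<Prod>i\<le>n. x - \<xi> i)" and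
      q2: "degree q2 \<le> n" "\<And>i. i \<le> n \<Longrightarrow> poly q2 (\<xi> (Suc i)) = truncated_power n t (\<xi> (Suc i))"
        "\<And>x. 0 \<le> (truncated_power n t x - poly q2 x) * (\<Prod>i\<le>n. x - \<xi> (Suc i))"
      by blast
    define q where "q = smult \<rho> ([:- \<xi> (Suc n), 1:] * q1) + smult \<kappa> ([:- \<xi> 0, 1:] * q2)"
    have step: "truncated_power (Suc n) t x = (x - t) * truncated_power n t x" for x
      by (simp add: truncated_power_def)
    have err: "truncated_power (Suc n) t x - poly q x =
        \<rho> * (x - \<xi> (Suc n)) * (truncated_power n t x - poly q1 x) +
        \<kappa> * (x - \<xi> 0) * (truncated_power n t x - poly q2 x)" for x
    proof -
      have "x - t = \<rho> * (x - \<xi> (Suc n)) + \<kappa> * (x - \<xi> 0)"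
        using coeffs(3,4) by algebra
      moreover have "poly q x = \<rho> * ((x - \<xi> (Suc n)) * poly q1 x) + \<kappa> * ((x - \<xi> 0) * poly q2 x)"
        by (simp add: q_def algebra_simps)
      ultimately show ?thesis
        unfolding step by algebra
    qed
    have "degree q \<le> Suc n"
      unfolding q_def using q1(1) q2(1)
      by (intro degree_add_le order.trans[OF degree_smult_le] order.trans[OF degree_mult_le]) auto
    moreover have "poly q (\<xi> i) = truncated_power (Suc n) t (\<xi> i)" if "i \<le> Suc n" for i
    proof -
      have "\<rho> * (\<xi> i - \<xi> (Suc n)) * (truncated_power n t (\<xi> i) - poly q1 (\<xi> i)) = 0"
        using that q1(2)[of i] by (cases "i = Suc n") auto
      moreover have "\<kappa> * (\<xi> i - \<xi> 0) * (truncated_power n t (\<xi> i) - poly q2 (\<xi> i)) = 0"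
        using that q2(2)[of "i - 1"] by (cases i) auto
      ultimately show ?thesis
        using err[of "\<xi> i"] by linarith
    qed
    moreover have "0 \<le> (truncated_power (Suc n) t x - poly q x) * (\<Prod>i\<le>Suc n. x - \<xi> i)" for x
    proof -
      have "(truncated_power (Suc n) t x - poly q x) * (\<Prod>i\<le>Suc n. x - \<xi> i) =
          \<rho> * (x - \<xi> (Suc n))\<^sup>2 * ((truncated_power n t x - poly q1 x) * (\<Prod>i\<le>n. x - \<xi> i)) +
          \<kappa> * (x - \<xi> 0)\<^sup>2 * ((truncated_power n t x - poly q2 x) * (\<Prod>i\<le>n. x - \<xi> (Suc i)))"
      proof -
        have "(\<Prod>i\<le>Suc n. x - \<xi> i) = (\<Prod>i\<le>n. x - \<xi> i) * (x - \<xi> (Suc n))"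
          by simp
        moreover have "(\<Prod>i\<le>Suc n. x - \<xi> i) = (x - \<xi> 0) * (\<Prod>i\<le>n. x - \<xi> (Suc i))"
          by (rule prod.atMost_Suc_shift)
        ultimately show ?thesis
          unfolding err by algebra
      qed
      also have "\<dots> \<ge> 0"
        by (intro add_nonneg_nonneg mult_nonneg_nonneg[OF mult_nonneg_nonneg]
            coeffs(1,2) zero_le_power2 q1(3) q2(3))
      finally show ?thesis .
    qed
    ultimately show ?thesis
      by blast
  qed
qed

lemma peano_kernel_sign:
  assumes "strict_mono_on {..n} \<xi>"
  shows "0 \<le> peano_kernel \<xi> n x t * (\<Prod>i\<le>n. x - \<xi> i)"
proof -
  obtain q where q: "degree q \<le> n" "\<forall>i\<le>n. poly q (\<xi> i) = truncated_power n t (\<xi> i)"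
    "\<forall>x. 0 \<le> (truncated_power n t x - poly q x) * (\<Prod>i\<le>n. x - \<xi> i)"
    using truncated_power_interpolant_sign[OF assms] by blast
  have "lagrange_interpolant \<xi> n (truncated_power n t) = q"
    using q assms by (intro lagrange_interpolant_unique) (auto dest: strict_mono_on_imp_inj_on)
  then show ?thesis
    using q(3) by (simp add: peano_kernel_def interpolation_error_def)
qed

section \<open>Peano's formula for everywhere differentiable functions\<close>

text \<open>Taylor's formula at \<open>a\<close> with Henstock-Kurzweil remainder, extended by zero to the whole line so
  that the domain of integration does not depend on \<open>y\<close> and the formulas for different \<open>y\<close> can be
  combined linearly.\<close>

lemma truncated_power_has_integral:
  fixes f :: "nat \<Rightarrow> real \<Rightarrow> real"
  assumes deriv: "\<And>k x. k \<le> n \<Longrightarrow> (f k has_real_derivative f (Suc k) x) (at x)" and "a \<le> y"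
  shows "((\<lambda>t. if a \<le> t then truncated_power n t y * f (Suc n) t else 0) has_integral
    fact n * (f 0 y - (\<Sum>k\<le>n. (y - a) ^ k / fact k * f k a))) UNIV"
proof -
  have "((\<lambda>t. ((y - t) ^ n / fact n) * f (Suc n) t) has_integral
      f 0 y - (\<Sum>k\<le>n. (y - a) ^ k / fact k * f k a)) {a..y}"
  proof -
    have "((\<lambda>t. ((y - t) ^ (Suc n - 1) / fact (Suc n - 1)) *\<^sub>R f (Suc n) t) has_integral
      f 0 y - (\<Sum>k<Suc n. ((y - a) ^ k / fact k) *\<^sub>R f k a)) {a..y}"
      using \<open>a \<le> y\<close> deriv
      by (intro Taylor_has_integral) 
         (auto simp: has_real_derivative_iff_has_vector_derivative[symmetric]
           intro: has_field_derivative_at_within)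
    then show ?thesis by (simp add: lessThan_Suc_atMost)
  qed
  from has_integral_mult_right[OF this, of "fact n"]
  have "((\<lambda>t. (y - t) ^ n * f (Suc n) t) has_integral
      fact n * (f 0 y - (\<Sum>k\<le>n. (y - a) ^ k / fact k * f k a))) {a..y}"
    by simp
  then have "((\<lambda>t. truncated_power n t y * f (Suc n) t) has_integral
      fact n * (f 0 y - (\<Sum>k\<le>n. (y - a) ^ k / fact k * f k a))) {a..y}"
    by (rule has_integral_spike[of "{y}", rotated 2]) (auto simp: truncated_power_def)
  then have "((\<lambda>t. if t \<in> {a..y} then truncated_power n t y * f (Suc n) t else 0) has_integral
      fact n * (f 0 y - (\<Sum>k\<le>n. (y - a) ^ k / fact k * f k a))) UNIV"
    by (simp only: has_integral_restrict_UNIV)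
  moreover have "(\<lambda>t. if t \<in> {a..y} then truncated_power n t y * f (Suc n) t else 0)
      = (\<lambda>t. if a \<le> t then truncated_power n t y * f (Suc n) t else 0)"
    by (auto simp: truncated_power_def)
  ultimately show ?thesis by simp
qed

lemma interpolation_error_has_integral:
  assumes "\<And>y. a \<le> y \<Longrightarrow> ((\<lambda>t. g t y) has_integral G y) UNIV"
    and "a \<le> x" "\<And>i. i \<le> n \<Longrightarrow> a \<le> \<xi> i"
  shows "((\<lambda>t. interpolation_error \<xi> n (g t) x) has_integral interpolation_error \<xi> n G x) UNIV"
  unfolding interpolation_error_sum using assms
  by (intro has_integral_diff has_integral_sum has_integral_mult_left) auto

text \<open>To the left of \<open>x\<close> and of all nodes the truncated power coincides, at all points that enter the
  error, with a polynomial of degree \<open>n\<close>, which interpolation reproduces.\<close>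

lemma peano_kernel_eq_0:
  assumes "inj_on \<xi> {..n}" "t < x" "\<And>i. i \<le> n \<Longrightarrow> t < \<xi> i"
  shows "peano_kernel \<xi> n x t = 0"
proof -
  have "peano_kernel \<xi> n x t = interpolation_error \<xi> n (poly ([:-t, 1:] ^ n)) x"
    unfolding peano_kernel_def using assms
    by (intro interpolation_error_cong) (auto simp: truncated_power_def)
  then show ?thesis
    by (simp add: interpolation_error_poly assms degree_linear_power)
qed

text \<open>Apply the interpolation error to Taylor's formula, expanded at a point \<open>a\<close> to the left of \<open>x\<close>
  and of all nodes: the Taylor polynomial is reproduced by interpolation and drops out. The result
  does not involve \<open>a\<close> because the kernel vanishes to the left of \<open>a\<close>.\<close>

lemma peano_kernel_has_integral:
  fixes f :: "nat \<Rightarrow> real \<Rightarrow> real"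
  assumes deriv: "\<And>k x. k \<le> n \<Longrightarrow> (f k has_real_derivative f (Suc k) x) (at x)"
    and inj: "inj_on \<xi> {..n}"
  shows "((\<lambda>t. peano_kernel \<xi> n x t * f (Suc n) t) has_integral
    fact n * interpolation_error \<xi> n (f 0) x) UNIV"
proof -
  define a where "a = Min (insert x (\<xi> ` {..n}))"
  have a: "a \<le> x" "\<And>i. i \<le> n \<Longrightarrow> a \<le> \<xi> i"
    unfolding a_def by (rule Min_le; simp)+
  define taylor where "taylor = (\<Sum>k\<le>n. smult (f k a / fact k) ([:-a, 1:] ^ k))"
  have taylor: "poly taylor y = (\<Sum>k\<le>n. (y - a) ^ k / fact k * f k a)" for y
    by (simp add: taylor_def poly_sum mult.commute)
  have "degree taylor \<le> n"
    unfolding taylor_def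
    by (intro degree_sum_le)
      (auto intro: order.trans[OF degree_smult_le] order.trans[OF degree_linear_power])
  then have err: "interpolation_error \<xi> n (\<lambda>y. fact n * (f 0 y - poly taylor y)) x
      = fact n * interpolation_error \<xi> n (f 0) x"
    using interpolation_error_poly[OF inj, of taylor x]
    by (simp add: interpolation_error_scale interpolation_error_diff)
  have "((\<lambda>t. interpolation_error \<xi> n
           (\<lambda>y. if a \<le> t then truncated_power n t y * f (Suc n) t else 0) x) has_integral
         interpolation_error \<xi> n (\<lambda>y. fact n * (f 0 y - poly taylor y)) x) UNIV"
    unfolding taylor using deriv a
    by (intro interpolation_error_has_integral[of a] truncated_power_has_integral) auto
  moreover have "interpolation_error \<xi> n
      (\<lambda>y. if a \<le> t then truncated_power n t y * f (Suc n) t else 0) x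
      = peano_kernel \<xi> n x t * f (Suc n) t" for t
  proof (cases "a \<le> t")
    case True
    then show ?thesis
      by (simp add: peano_kernel_def interpolation_error_sum right_diff_distrib sum_distrib_left mult_ac)
  next
    case False
    then have "peano_kernel \<xi> n x t = 0"
      using a by (intro peano_kernel_eq_0 inj) force+
    with False show ?thesis
      by (simp add: interpolation_error_sum)
  qed
  ultimately show ?thesis
    by (simp add: err)
qed

section \<open>The points of sign change\<close>

text \<open>The separators are the right endpoints of the intervals. They are strictly increasing because the
  intervals have interior points.\<close>

lemma ordered_interval_partition_separators:
  assumes "ordered_interval_partition m I"
  obtains \<xi> where "strict_mono_on {..<m} \<xi>"
    "\<And>i j x. i < j \<Longrightarrow> j \<le> m \<Longrightarrow> x \<in> I j \<Longrightarrow> \<xi> i \<le> x"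
    "\<And>i j x. j \<le> i \<Longrightarrow> i < m \<Longrightarrow> x \<in> I j \<Longrightarrow> x \<le> \<xi> i"
proof -
  have ord: "x < y" if "i < j" "j \<le> m" "x \<in> I i" "y \<in> I j" for i j x y
    using assms that(1,2) unfolding ordered_interval_partition_def
    by (elim conjE allE[of _ i] allE[of _ j]) (use that in auto)
  have ne: "interior (I i) \<noteq> {}" if "i \<le> m" for i
    using assms that unfolding ordered_interval_partition_def by simp
  define \<xi> where "\<xi> i = Sup (I i)" for i
  have ne': "I i \<noteq> {}" if "i \<le> m" for i
    using ne[OF that] interior_subset by blast
  have bdd: "bdd_above (I i)" if "i < m" for i
  proof -
    obtain y where "y \<in> I (Suc i)" using ne'[of "Suc i"] \<open>i < m\<close> by auto
    then have "x \<le> y" if "x \<in> I i" for x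
      using ord[of i "Suc i" x y] that \<open>i < m\<close> by simp
    then show ?thesis by (rule bdd_aboveI)
  qed
  have below: "\<xi> i \<le> x" if "i < j" "j \<le> m" "x \<in> I j" for i j x
  proof -
    have "I i \<noteq> {}" using ne'[of i] that by simp
    moreover have "y \<le> x" if "y \<in> I i" for y
      using ord[OF \<open>i < j\<close> \<open>j \<le> m\<close> that \<open>x \<in> I j\<close>] by simp
    ultimately show ?thesis
      unfolding \<xi>_def by (rule cSup_least)
  qed
  have above: "x \<le> \<xi> i" if "j \<le> i" "i < m" "x \<in> I j" for i j x
  proof (cases "j = i")
    case True
    then show ?thesis
      using cSup_upper[of x "I i"] bdd[of i] that by (simp add: \<xi>_def)
  next
    case False
    obtain y where "y \<in> I i" using ne'[of i] \<open>i < m\<close> by auto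
    then have "x < y" "y \<le> \<xi> i"
      using ord[of j i x y] that False bdd[of i] cSup_upper[of y "I i"] by (simp_all add: \<xi>_def)
    then show ?thesis by simp
  qed
  have mono: "strict_mono_on {..<m} \<xi>"
  proof (rule strict_mono_onI)
    fix i j assume ij: "i \<in> {..<m}" "j \<in> {..<m}" "i < j"
    obtain x where "x \<in> interior (I j)"
      using ne[of j] ij by auto
    then obtain e where "e > 0" "cball x e \<subseteq> I j"
      by (auto simp: mem_interior_cball)
    then have "x \<in> I j" "x + e \<in> I j"
      by (auto simp: subset_iff dist_real_def)
    then show "\<xi> i < \<xi> j"
      using below[of i j x] above[of j j "x + e"] ij \<open>e > 0\<close> by auto
  qed
  show ?thesis
    using that[OF mono] below above by blast
qed

text \<open>Counted from the right, \<open>P\<close> is positive on the intervals of even index and negative on those of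
  odd index. The product has \<open>m - j\<close> nonpositive factors on the \<open>j\<close>-th interval, so the signs
  agree.\<close>

lemma sign_change_nodes:
  assumes "sign_change_partition m P I" and "positive_on P (I m)"
  obtains \<xi> where "strict_mono_on {..<m} \<xi>" "\<And>x. 0 \<le> P x * (\<Prod>i<m. x - \<xi> i)"
proof -
  have part: "ordered_interval_partition m I"
    and alt: "\<And>i. i < m \<Longrightarrow> positive_on P (I i) \<longleftrightarrow> negative_on P (I (Suc i))"
    and dich: "\<And>i. i \<le> m \<Longrightarrow> positive_on P (I i) \<or> negative_on P (I i)"
    using assms(1) by (auto simp: sign_change_partition_def)
  have not_both: "\<not> (positive_on P J \<and> negative_on P J)" for J
    by (force simp: positive_on_def negative_on_def)
  have sign: "if even k then positive_on P (I (m - k)) else negative_on P (I (m - k))"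
    if "k \<le> m" for k
    using that
  proof (induction k)
    case (Suc k)
    then have "Suc (m - Suc k) = m - k" by simp
    then show ?case
      using Suc alt[of "m - Suc k"] dich[of "m - Suc k"] dich[of "m - k"] not_both[of "I (m - k)"]
      by (auto split: if_splits)
  qed (use assms(2) in simp)
  obtain \<xi> where \<xi>: "strict_mono_on {..<m} \<xi>"
    "\<And>i j x. i < j \<Longrightarrow> j \<le> m \<Longrightarrow> x \<in> I j \<Longrightarrow> \<xi> i \<le> x"
    "\<And>i j x. j \<le> i \<Longrightarrow> i < m \<Longrightarrow> x \<in> I j \<Longrightarrow> x \<le> \<xi> i"
    using ordered_interval_partition_separators[OF part] by blast
  have "0 \<le> P x * (\<Prod>i<m. x - \<xi> i)" for x
  proof -
    have "x \<in> (\<Union>i\<le>m. I i)"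
      using part by (simp add: ordered_interval_partition_def)
    then obtain j where j: "j \<le> m" "x \<in> I j" by auto
    have "0 \<le> (-1) ^ (m - j) * P x"
      using sign[of "m - j"] j by (auto simp: positive_on_def negative_on_def split: if_splits)
    moreover have "0 \<le> (-1) ^ (m - j) * (\<Prod>i<m. x - \<xi> i)"
    proof -
      have "(\<Prod>i<m. x - \<xi> i) = (\<Prod>i<j. x - \<xi> i) * (\<Prod>i=j..<m. x - \<xi> i)"
        using prod.atLeastLessThan_concat[of 0 j m "\<lambda>i. x - \<xi> i"] j
        by (simp add: atLeast0LessThan)
      also have "(\<Prod>i=j..<m. x - \<xi> i) = (\<Prod>i=j..<m. -1 * (\<xi> i - x))"
        by simp
      also have "\<dots> = (-1) ^ (m - j) * (\<Prod>i=j..<m. \<xi> i - x)"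
        by (subst prod.distrib) simp
      finally have "(-1) ^ (m - j) * (\<Prod>i<m. x - \<xi> i)
          = ((-1) ^ (m - j))\<^sup>2 * ((\<Prod>i<j. x - \<xi> i) * (\<Prod>i=j..<m. \<xi> i - x))"
        by (simp add: power2_eq_square)
      also have "\<dots> \<ge> 0"
        using \<xi>(2,3) j by (intro mult_nonneg_nonneg prod_nonneg) auto
      finally show ?thesis .
    qed
    ultimately have "0 \<le> ((-1) ^ (m - j) * P x) * ((-1) ^ (m - j) * (\<Prod>i<m. x - \<xi> i))"
      by (rule mult_nonneg_nonneg)
    also have "\<dots> = ((-1) ^ (m - j))\<^sup>2 * (P x * (\<Prod>i<m. x - \<xi> i))"
      by (simp add: power2_eq_square)
    also have "((-1) ^ (m - j))\<^sup>2 = (1 :: real)"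
      by (simp add: power2_eq_square flip: power_mult_distrib)
    finally show ?thesis
      by simp
  qed
  with \<xi>(1) show ?thesis by (rule that)
qed

section \<open>The law for at least one sign change\<close>

lemma borel_measurable_poly [measurable (raw)]:
  fixes q :: "real poly"
  assumes "f \<in> borel_measurable N"
  shows "(\<lambda>p. poly q (f p)) \<in> borel_measurable N"
  using assms
  by (rule measurable_compose) (intro borel_measurable_continuous_onI continuous_intros)

lemma borel_measurable_truncated_power [measurable (raw)]:
  assumes [measurable]: "f \<in> borel_measurable N" "g \<in> borel_measurable N"
  shows "(\<lambda>p. truncated_power n (f p) (g p)) \<in> borel_measurable N"
  unfolding truncated_power_def by measurable

lemma borel_measurable_peano_kernel [measurable (raw)]:
  assumes [measurable]: "f \<in> borel_measurable N" "g \<in> borel_measurable N"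
  shows "(\<lambda>p. peano_kernel \<xi> n (f p) (g p)) \<in> borel_measurable N"
  unfolding peano_kernel_def interpolation_error_sum by measurable

text \<open>The hypotheses of the theorem for \<open>m = n + 1\<close>, with the interval partition replaced by its
  separating points.\<close>

locale signed_moments = prob_space M for M :: "'a measure" +
  fixes X :: "'a \<Rightarrow> real" and P :: "real \<Rightarrow> real" and n :: nat
    and \<xi> :: "nat \<Rightarrow> real" and \<alpha> :: real
  assumes X [measurable]: "X \<in> borel_measurable M"
    and P [measurable]: "P \<in> borel_measurable borel"
    and nodes: "strict_mono_on {..n} \<xi>"
    and sign: "0 \<le> P x * (\<Prod>i\<le>n. x - \<xi> i)"
    and integrable_moment: "k \<le> Suc n \<Longrightarrow> integrable M (\<lambda>\<omega>. X \<omega> ^ k * P (X \<omega>))"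
    and moment_zero: "k \<le> n \<Longrightarrow> (\<integral>\<omega>. X \<omega> ^ k * P (X \<omega>) \<partial>M) = 0"
    and moment_top: "(\<integral>\<omega>. X \<omega> ^ Suc n * P (X \<omega>) \<partial>M) = \<alpha> * fact (Suc n)"
    and \<alpha>_pos: "0 < \<alpha>"
begin

text \<open>The divisor combines the factorial from Peano's formula with the \<open>\<alpha>\<close> that makes the total mass of
  the law equal to \<open>1\<close>.\<close>

definition weight :: "'a \<Rightarrow> real \<Rightarrow> real" where
  "weight \<omega> t = P (X \<omega>) * peano_kernel \<xi> n (X \<omega>) t / (\<alpha> * fact n)"

definition law :: "real measure" where
  "law = density lborel (\<lambda>t. \<integral>\<^sup>+\<omega>. ennreal (weight \<omega> t) \<partial>M)"

lemma inj_nodes: "inj_on \<xi> {..n}"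
  using nodes by (rule strict_mono_on_imp_inj_on)

text \<open>Both \<open>P\<close> and the kernel have the sign of the node product, and where that product vanishes \<open>X\<close> is
  at a node, so the kernel is \<open>0\<close>.\<close>

lemma weight_nonneg: "0 \<le> weight \<omega> t"
proof -
  let ?x = "X \<omega>" and ?w = "\<Prod>i\<le>n. X \<omega> - \<xi> i"
  have "0 \<le> P ?x * peano_kernel \<xi> n ?x t"
  proof (cases "?w = 0")
    case True
    then obtain i where "i \<le> n" "?x = \<xi> i"
      by (auto simp: prod_zero_iff)
    then show ?thesis
      using interpolation_error_node[OF inj_nodes, of i] by (simp add: peano_kernel_def)
  next
    case False
    have "0 \<le> (P ?x * ?w) * (peano_kernel \<xi> n ?x t * ?w)"
      using sign peano_kernel_sign[OF nodes] by (rule mult_nonneg_nonneg)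
    also have "\<dots> = (P ?x * peano_kernel \<xi> n ?x t) * ?w\<^sup>2"
      by (simp add: power2_eq_square)
    finally show ?thesis
      using False by (simp add: zero_le_mult_iff)
  qed
  then show ?thesis
    using \<alpha>_pos by (simp add: weight_def)
qed

lemma measurable_weight [measurable]:
  "(\<lambda>(\<omega>, t). weight \<omega> t) \<in> borel_measurable (M \<Otimes>\<^sub>M lborel)"
  unfolding weight_def by measurable

lemma measurable_weight2 [measurable]: "weight \<omega> \<in> borel_measurable borel"
  unfolding weight_def by measurable

lemma sets_law [simp, measurable_cong]: "sets law = sets borel"
  by (simp add: law_def)

text \<open>By Tonelli's theorem. Every integral with respect to the law is computed through this formula.\<close>

lemma nn_integral_law:
  assumes [measurable]: "\<phi> \<in> borel_measurable borel"
  shows "(\<integral>\<^sup>+t. \<phi> t \<partial>law) = (\<integral>\<^sup>+\<omega>. \<integral>\<^sup>+t. ennreal (weight \<omega> t) * \<phi> t \<partial>lborel \<partial>M)"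
proof -
  interpret pair_sigma_finite M lborel ..
  have "(\<integral>\<^sup>+t. \<phi> t \<partial>law) = (\<integral>\<^sup>+t. (\<integral>\<^sup>+\<omega>. ennreal (weight \<omega> t) \<partial>M) * \<phi> t \<partial>lborel)"
    unfolding law_def by (intro nn_integral_density) measurable
  also have "\<dots> = (\<integral>\<^sup>+t. \<integral>\<^sup>+\<omega>. ennreal (weight \<omega> t) * \<phi> t \<partial>M \<partial>lborel)"
    by (intro nn_integral_cong nn_integral_multc[symmetric]) measurable
  also have "\<dots> = (\<integral>\<^sup>+\<omega>. \<integral>\<^sup>+t. ennreal (weight \<omega> t) * \<phi> t \<partial>lborel \<partial>M)"
    by (intro Fubini') measurable
  finally show ?thesis .
qed

lemma weight_has_integral:
  fixes f :: "nat \<Rightarrow> real \<Rightarrow> real"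
  assumes "\<And>k x. k \<le> n \<Longrightarrow> (f k has_real_derivative f (Suc k) x) (at x)"
  shows "((\<lambda>t. weight \<omega> t * f (Suc n) t) has_integral
    P (X \<omega>) * interpolation_error \<xi> n (f 0) (X \<omega>) / \<alpha>) UNIV"
proof -
  define c where "c = P (X \<omega>) / (\<alpha> * fact n)"
  have "((\<lambda>t. c * (peano_kernel \<xi> n (X \<omega>) t * f (Suc n) t)) has_integral
      c * (fact n * interpolation_error \<xi> n (f 0) (X \<omega>))) UNIV"
    by (intro has_integral_mult_right peano_kernel_has_integral assms inj_nodes)
  moreover have "c * (fact n * r) = P (X \<omega>) * r / \<alpha>" for r
    by (simp add: c_def)
  moreover have "c * (peano_kernel \<xi> n (X \<omega>) t * r) = weight \<omega> t * r" for t r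
    by (simp add: c_def weight_def)
  ultimately show ?thesis by simp
qed

lemma poly_orthogonal:
  assumes "degree q \<le> n"
  shows "integrable M (\<lambda>\<omega>. P (X \<omega>) * poly q (X \<omega>))"
    and "(\<integral>\<omega>. P (X \<omega>) * poly q (X \<omega>) \<partial>M) = 0"
proof -
  have eq: "P (X \<omega>) * poly q (X \<omega>) = (\<Sum>k\<le>degree q. coeff q k * (X \<omega> ^ k * P (X \<omega>)))" for \<omega>
    by (simp add: poly_altdef sum_distrib_left mult_ac)
  have int: "integrable M (\<lambda>\<omega>. coeff q k * (X \<omega> ^ k * P (X \<omega>)))" if "k \<le> degree q" for k
    using that assms integrable_moment[of k] by simp
  show "integrable M (\<lambda>\<omega>. P (X \<omega>) * poly q (X \<omega>))"
    unfolding eq using int by (intro Bochner_Integration.integrable_sum) auto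
  have "(\<integral>\<omega>. P (X \<omega>) * poly q (X \<omega>) \<partial>M)
      = (\<Sum>k\<le>degree q. \<integral>\<omega>. coeff q k * (X \<omega> ^ k * P (X \<omega>)) \<partial>M)"
    unfolding eq using int by (intro Bochner_Integration.integral_sum) auto
  also have "\<dots> = 0"
    using assms moment_zero by (intro sum.neutral) auto
  finally show "(\<integral>\<omega>. P (X \<omega>) * poly q (X \<omega>) \<partial>M) = 0" .
qed

text \<open>The interpolating polynomial has degree at most \<open>n\<close>, so subtracting it does not change the
  expectation.\<close>

lemma expectation_interpolation_error:
  assumes "integrable M (\<lambda>\<omega>. P (X \<omega>) * g (X \<omega>))"
  shows "has_bochner_integral M (\<lambda>\<omega>. P (X \<omega>) * interpolation_error \<xi> n g (X \<omega>) / \<alpha>)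
    ((\<integral>\<omega>. P (X \<omega>) * g (X \<omega>) \<partial>M) / \<alpha>)"
proof -
  note q = poly_orthogonal[OF degree_lagrange_interpolant[of \<xi> n g]]
  have "has_bochner_integral M
      (\<lambda>\<omega>. (P (X \<omega>) * g (X \<omega>) - P (X \<omega>) * poly (lagrange_interpolant \<xi> n g) (X \<omega>)) / \<alpha>)
      (((\<integral>\<omega>. P (X \<omega>) * g (X \<omega>) \<partial>M) - 0) / \<alpha>)"
    using assms q \<alpha>_pos
    by (intro has_bochner_integral_divide has_bochner_integral_diff)
       (auto simp: has_bochner_integral_iff)
  then show ?thesis
    by (simp add: interpolation_error_def right_diff_distrib)
qed

text \<open>The total mass is the integral of the constant \<open>1\<close>, which is the \<open>m\<close>-th derivative of
  \<open>x\<^sup>m / m!\<close>; the normalisation of the \<open>m\<close>-th moment makes it \<open>1\<close>.\<close>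

lemma real_distribution_law: "real_distribution law"
proof -
  define f :: "nat \<Rightarrow> real \<Rightarrow> real" where "f k x = x ^ (Suc n - k) / fact (Suc n - k)" for k x
  have deriv: "(f k has_real_derivative f (Suc k) x) (at x)" if "k \<le> n" for k x
  proof -
    \<comment> \<open>written with \<open>Suc (n - k)\<close> so that the factorial cancels against the exponent\<close>
    have "((\<lambda>x. x ^ Suc (n - k) / fact (Suc (n - k))) has_real_derivative
        (real (Suc (n - k)) * x ^ (n - k) / fact (Suc (n - k)))) (at x)"
      using DERIV_cdivide[OF DERIV_pow[of "Suc (n - k)" x UNIV], of "fact (Suc (n - k))"]
      by (simp only: diff_Suc_Suc diff_zero)
    also have "real (Suc (n - k)) * x ^ (n - k) / fact (Suc (n - k)) = x ^ (n - k) / fact (n - k)"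
      by (simp only: fact_Suc of_nat_mult mult_divide_mult_cancel_left[OF of_nat_neq_0])
    finally have "((\<lambda>x. x ^ Suc (n - k) / fact (Suc (n - k))) has_real_derivative
        (x ^ (n - k) / fact (n - k))) (at x)" .
    moreover have "f k = (\<lambda>x. x ^ Suc (n - k) / fact (Suc (n - k)))"
      using that by (simp add: f_def fun_eq_iff Suc_diff_le del: power_Suc fact_Suc)
    ultimately show ?thesis
      by (simp add: f_def del: power_Suc fact_Suc)
  qed
  have f0: "f 0 x = x ^ Suc n / fact (Suc n)" and fn: "f (Suc n) x = 1" for x
    by (simp_all add: f_def)
  have "has_bochner_integral M (\<lambda>\<omega>. P (X \<omega>) * interpolation_error \<xi> n (f 0) (X \<omega>) / \<alpha>)
      ((\<integral>\<omega>. P (X \<omega>) * f 0 (X \<omega>) \<partial>M) / \<alpha>)"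
    using integrable_moment[of "Suc n"]
    by (intro expectation_interpolation_error) 
      (simp add: f0 mult_ac del: power_Suc fact_Suc)
  also have "(\<integral>\<omega>. P (X \<omega>) * f 0 (X \<omega>) \<partial>M) / \<alpha> = 1"
    using moment_top \<alpha>_pos by (simp add: f0 mult_ac del: power_Suc fact_Suc)
  finally have e: "has_bochner_integral M
      (\<lambda>\<omega>. P (X \<omega>) * interpolation_error \<xi> n (f 0) (X \<omega>) / \<alpha>) 1" .
  have int: "(weight \<omega> has_integral P (X \<omega>) * interpolation_error \<xi> n (f 0) (X \<omega>) / \<alpha>) UNIV" for \<omega>
    using weight_has_integral[where f = f and \<omega> = \<omega>, OF deriv] by (simp add: fn)
  have "emeasure law (space law) = (\<integral>\<^sup>+t. 1 \<partial>law)"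
    by simp
  also have "\<dots> = (\<integral>\<^sup>+\<omega>. \<integral>\<^sup>+t. ennreal (weight \<omega> t) \<partial>lborel \<partial>M)"
    by (subst nn_integral_law) simp_all
  also have "\<dots> = (\<integral>\<^sup>+\<omega>. ennreal (P (X \<omega>) * interpolation_error \<xi> n (f 0) (X \<omega>) / \<alpha>) \<partial>M)"
    using weight_nonneg int by (intro nn_integral_cong nn_integral_has_integral_lborel) auto
  also have "\<dots> = ennreal 1"
    using e has_integral_nonneg[OF int weight_nonneg]
    by (subst nn_integral_eq_integral) (auto simp: has_bochner_integral_iff)
  finally have "prob_space law"
    by (intro prob_spaceI) simp
  then show ?thesis
    by (simp add: real_distribution_def real_distribution_axioms_def)
qed

text \<open>Write \<open>g\<close> for the top derivative and, for each outcome \<open>\<omega>\<close>, let \<open>pos \<omega>\<close> and \<open>neg \<omega>\<close> be the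
  weighted Lebesgue integrals of its two parts, and \<open>e \<omega>\<close> its weighted Henstock-Kurzweil integral.
  The assumption says that \<open>neg\<close> has finite expectation, so it is almost surely finite. Where it is
  finite, adding the integrable negative part to the Henstock-Kurzweil integrable function gives a
  nonnegative Henstock-Kurzweil integrable function, which is Lebesgue integrable, and
  \<open>pos \<omega> = e \<omega> + neg \<omega>\<close>. Since \<open>e\<close> is integrable over \<open>\<omega>\<close>, so is \<open>pos\<close>, and the integral of \<open>g\<close>
  under the law is the expectation of \<open>pos - neg = e\<close>.\<close>

lemma law_identity:
  fixes f :: "nat \<Rightarrow> real \<Rightarrow> real"
  assumes deriv: "\<And>k x. k \<le> n \<Longrightarrow> (f k has_real_derivative f (Suc k) x) (at x)"
    and meas [measurable]: "f (Suc n) \<in> borel_measurable borel"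
    and int: "integrable M (\<lambda>\<omega>. P (X \<omega>) * f 0 (X \<omega>))"
    and fin: "(\<integral>\<^sup>+t. ennreal (- f (Suc n) t) \<partial>law) < \<infinity>"
  shows "has_bochner_integral law (f (Suc n)) ((\<integral>\<omega>. P (X \<omega>) * f 0 (X \<omega>) \<partial>M) / \<alpha>)"
proof -
  define e where "e \<omega> = P (X \<omega>) * interpolation_error \<xi> n (f 0) (X \<omega>) / \<alpha>" for \<omega>
  define g where "g = f (Suc n)"
  have [measurable]: "g \<in> borel_measurable borel" by (simp add: g_def)
  have e: "has_bochner_integral M e ((\<integral>\<omega>. P (X \<omega>) * f 0 (X \<omega>) \<partial>M) / \<alpha>)"
    unfolding e_def by (rule expectation_interpolation_error[OF int])
  then have int_e: "integrable M e" by (simp add: has_bochner_integral_iff)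
  have hk: "((\<lambda>t. weight \<omega> t * g t) has_integral e \<omega>) UNIV" for \<omega>
    unfolding e_def g_def by (rule weight_has_integral[where f = f, OF deriv])
  define pos neg where
    "pos \<omega> = (\<integral>\<^sup>+t. ennreal (weight \<omega> t) * ennreal (g t) \<partial>lborel)" and
    "neg \<omega> = (\<integral>\<^sup>+t. ennreal (weight \<omega> t) * ennreal (- g t) \<partial>lborel)" for \<omega>
  have [measurable]: "neg \<in> borel_measurable M"
    unfolding neg_def by measurable
  have law_pos: "(\<integral>\<^sup>+t. ennreal (g t) \<partial>law) = (\<integral>\<^sup>+\<omega>. pos \<omega> \<partial>M)"
    and law_neg: "(\<integral>\<^sup>+t. ennreal (- g t) \<partial>law) = (\<integral>\<^sup>+\<omega>. neg \<omega> \<partial>M)"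
    unfolding pos_def neg_def by (simp_all add: nn_integral_law)
  have "AE \<omega> in M. neg \<omega> \<noteq> \<infinity>"
    using fin law_neg by (intro nn_integral_PInf_AE) (auto simp: g_def)
  then have AE: "AE \<omega> in M. neg \<omega> = ennreal (enn2real (neg \<omega>)) \<and>
      0 \<le> e \<omega> + enn2real (neg \<omega>) \<and> pos \<omega> = ennreal (e \<omega> + enn2real (neg \<omega>))"
  proof eventually_elim
    case (elim \<omega>)
    define I where "I = enn2real (neg \<omega>)"
    have neg: "neg \<omega> = ennreal I"
      using elim by (simp add: I_def less_top)
    have prod: "ennreal (weight \<omega> t) * ennreal r = ennreal (weight \<omega> t * max 0 r)" for t r
      using weight_nonneg[of \<omega> t] by (simp add: ennreal_mult'[symmetric] max_def ennreal_neg mult_nonneg_nonpos)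
    have "has_bochner_integral lborel (\<lambda>t. weight \<omega> t * max 0 (- g t)) I"
      using neg weight_nonneg unfolding neg_def prod
      by (intro has_bochner_integral_nn_integral) (auto simp: I_def)
    then have "((\<lambda>t. weight \<omega> t * max 0 (- g t)) has_integral I) UNIV"
      using has_integral_integral_lborel by (auto simp: has_bochner_integral_iff)
    from has_integral_add[OF hk this]
    have "((\<lambda>t. weight \<omega> t * g t + weight \<omega> t * max 0 (- g t)) has_integral e \<omega> + I) UNIV" .
    also have "(\<lambda>t. weight \<omega> t * g t + weight \<omega> t * max 0 (- g t))
        = (\<lambda>t. weight \<omega> t * max 0 (g t))"
      by (auto simp: max_def)
    finally have hi: "((\<lambda>t. weight \<omega> t * max 0 (g t)) has_integral e \<omega> + I) UNIV" .
    have "0 \<le> e \<omega> + I"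
      using weight_nonneg by (intro has_integral_nonneg[OF hi]) auto
    moreover have "pos \<omega> = ennreal (e \<omega> + I)"
      unfolding pos_def prod using weight_nonneg
      by (intro nn_integral_has_integral_lborel[OF _ _ hi]) auto
    ultimately show ?case
      using neg unfolding I_def by blast
  qed
  have fin': "(\<integral>\<^sup>+\<omega>. neg \<omega> \<partial>M) < \<infinity>"
    using fin law_neg by (simp add: g_def)
  have neg_eq: "(\<integral>\<^sup>+\<omega>. neg \<omega> \<partial>M) = (\<integral>\<^sup>+\<omega>. ennreal (enn2real (neg \<omega>)) \<partial>M)"
    using AE by (intro nn_integral_cong_AE) auto
  then have int_neg: "integrable M (\<lambda>\<omega>. enn2real (neg \<omega>))"
    using fin' by (intro integrableI_nonneg) auto
  have "(\<integral>\<^sup>+t. ennreal (- g t) \<partial>law) = ennreal (\<integral>\<omega>. enn2real (neg \<omega>) \<partial>M)"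
    unfolding law_neg neg_eq using int_neg by (intro nn_integral_eq_integral) auto
  moreover have "(\<integral>\<^sup>+t. ennreal (g t) \<partial>law) = ennreal (\<integral>\<omega>. e \<omega> + enn2real (neg \<omega>) \<partial>M)"
  proof -
    have "(\<integral>\<^sup>+\<omega>. pos \<omega> \<partial>M) = (\<integral>\<^sup>+\<omega>. ennreal (e \<omega> + enn2real (neg \<omega>)) \<partial>M)"
      using AE by (intro nn_integral_cong_AE) auto
    also have "\<dots> = ennreal (\<integral>\<omega>. e \<omega> + enn2real (neg \<omega>) \<partial>M)"
      using AE int_e int_neg by (intro nn_integral_eq_integral) auto
    finally show ?thesis
      by (simp add: law_pos)
  qed
  moreover have "0 \<le> (\<integral>\<omega>. e \<omega> + enn2real (neg \<omega>) \<partial>M)" 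
    using AE by (intro integral_nonneg_AE) auto
  moreover have "0 \<le> (\<integral>\<omega>. enn2real (neg \<omega>) \<partial>M)"
    by simp
  moreover have "(\<integral>\<omega>. e \<omega> + enn2real (neg \<omega>) \<partial>M)
      = (\<integral>\<omega>. e \<omega> \<partial>M) + (\<integral>\<omega>. enn2real (neg \<omega>) \<partial>M)"
    using int_e int_neg by (rule Bochner_Integration.integral_add)
  ultimately have "integrable law g" "integral\<^sup>L law g = (\<integral>\<omega>. e \<omega> \<partial>M)"
    by (auto simp: real_integrable_def real_lebesgue_integral_def)
  then show ?thesis
    using e by (simp add: has_bochner_integral_iff g_def)
qed

text \<open>When it is the positive part of the derivative that has finite integral, the identity is applied
  to \<open>- F\<close>.\<close>

lemma characterizes_law: "characterizes law M X (Suc n) P \<alpha>"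
  unfolding characterizes_def
proof (intro ballI impI)
  fix F assume F: "F \<in> test_class M X (Suc n) P"
    and ex: "expectation_exists law ((deriv ^^ Suc n) F)"
  define f where "f k = (deriv ^^ k) F" for k
  have deriv: "(f k has_real_derivative f (Suc k) x) (at x)" if "k \<le> n" for k x
    using F that DERIV_deriv_iff_real_differentiable[of "f k" x]
    by (auto simp: f_def test_class_def diff_class_def less_Suc_eq_le)
  have f0: "f 0 = F" by (simp add: f_def)
  have meas: "f (Suc n) \<in> borel_measurable borel"
    using F by (simp add: f_def test_class_def diff_class_def)
  have [measurable]: "F \<in> borel_measurable borel"
    using deriv[of 0] unfolding f0
    by (intro borel_measurable_continuous_onI continuous_at_imp_continuous_on ballI)
      (auto intro: DERIV_isCont)
  have int: "integrable M (\<lambda>\<omega>. P (X \<omega>) * f 0 (X \<omega>))"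
    using F unfolding f0 test_class_def by (auto intro: integrable_abs_cancel)
  have "has_bochner_integral law (f (Suc n)) ((\<integral>\<omega>. P (X \<omega>) * f 0 (X \<omega>) \<partial>M) / \<alpha>)"
  proof (cases "(\<integral>\<^sup>+t. ennreal (- f (Suc n) t) \<partial>law) < \<infinity>")
    case True
    then show ?thesis
      using law_identity[where f = f, OF deriv meas int] by simp
  next
    case False
    then have "(\<integral>\<^sup>+t. ennreal (- (- f (Suc n) t)) \<partial>law) < \<infinity>"
      using ex by (simp add: expectation_exists_def f_def)
    moreover have "integrable M (\<lambda>\<omega>. P (X \<omega>) * - f 0 (X \<omega>))"
      using int by simp
    ultimately have "has_bochner_integral law (\<lambda>t. - f (Suc n) t)
        ((\<integral>\<omega>. P (X \<omega>) * - f 0 (X \<omega>) \<partial>M) / \<alpha>)"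
      using law_identity[of "\<lambda>k x. - f k x"] deriv meas by (simp add: DERIV_minus)
    from has_bochner_integral_minus[OF this] show ?thesis
      by simp
  qed
  then show "integrable law ((deriv ^^ Suc n) F) \<and>
      (\<integral>\<omega>. P (X \<omega>) * F (X \<omega>) \<partial>M) = \<alpha> * (\<integral>x. (deriv ^^ Suc n) F x \<partial>law)"
    using \<alpha>_pos by (simp add: has_bochner_integral_iff f_def)
qed

end

section \<open>The law when there is no sign change\<close>

lemma existence_no_sign_change:
  assumes "prob_space M" and [measurable]: "X \<in> borel_measurable M" "P \<in> borel_measurable borel"
    and nonneg: "\<And>x. 0 \<le> P x"
    and int: "integrable M (\<lambda>\<omega>. P (X \<omega>))" and mean: "(\<integral>\<omega>. P (X \<omega>) \<partial>M) = \<alpha>"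
    and \<alpha>: "0 < \<alpha>"
  shows "\<exists>\<nu>. real_distribution \<nu> \<and> characterizes \<nu> M X 0 P \<alpha>"
proof -
  interpret prob_space M by fact
  define \<nu> where "\<nu> = density (distr M borel X) (\<lambda>x. ennreal (P x / \<alpha>))"
  have "emeasure \<nu> (space \<nu>) = (\<integral>\<^sup>+\<omega>. ennreal (P (X \<omega>) / \<alpha>) \<partial>M)"
    by (simp add: \<nu>_def emeasure_density nn_integral_distr)
  also have "\<dots> = ennreal (\<integral>\<omega>. P (X \<omega>) / \<alpha> \<partial>M)"
    using int nonneg \<alpha> by (intro nn_integral_eq_integral) auto
  also have "\<dots> = 1"
    using mean \<alpha> by simp
  finally have "prob_space \<nu>"
    by (rule prob_spaceI)
  then have "real_distribution \<nu>"
    by (simp add: real_distribution_def real_distribution_axioms_def \<nu>_def)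
  moreover have "characterizes \<nu> M X 0 P \<alpha>"
    unfolding characterizes_def
  proof (intro ballI impI)
    fix F assume "F \<in> test_class M X 0 P"
    then have F [measurable]: "F \<in> borel_measurable borel"
      and "integrable M (\<lambda>\<omega>. P (X \<omega>) * F (X \<omega>))"
      by (auto simp: test_class_def diff_class_def intro: integrable_abs_cancel)
    then show "integrable \<nu> ((deriv ^^ 0) F) \<and>
        (\<integral>\<omega>. P (X \<omega>) * F (X \<omega>) \<partial>M) = \<alpha> * (\<integral>x. (deriv ^^ 0) F x \<partial>\<nu>)"
      using nonneg \<alpha>
      by (simp add: \<nu>_def integrable_density integral_density integrable_distr_eq integral_distr)
  qed
  ultimately show ?thesis by blast
qed

section \<open>Uniqueness\<close>

lemma higher_deriv_cos:
  "(deriv ^^ k) (\<lambda>x. c * cos (u * x + b)) = (\<lambda>x::real. c * u ^ k * cos (u * x + b + k * (pi / 2)))"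
proof (induction k)
  case (Suc k)
  have "((\<lambda>x. c * u ^ k * cos (u * x + b + k * (pi / 2))) has_real_derivative
      c * u ^ Suc k * cos (u * x + b + Suc k * (pi / 2))) (at x)" for x
  proof -
    have "cos (u * x + b + Suc k * (pi / 2)) = cos ((u * x + b + k * (pi / 2)) + pi / 2)"
      by (simp add: algebra_simps add_divide_distrib)
    also have "\<dots> = - sin (u * x + b + k * (pi / 2))"
      by (simp add: cos_add)
    finally have eq: "cos (u * x + b + Suc k * (pi / 2)) = - sin (u * x + b + k * (pi / 2))" .
    show ?thesis unfolding eq
      by (rule derivative_eq_intros refl | simp)+
  qed
  then show ?case
    using Suc.IH by (auto intro!: DERIV_imp_deriv)
qed simp

text \<open>The test function is a cosine of frequency \<open>u\<close>, with its phase and amplitude chosen such that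
  differentiating \<open>m\<close> times, each time a phase shift by \<open>pi / 2\<close> and a factor \<open>u\<close>, yields
  \<open>cos (u x + b)\<close>. Being bounded, it is in the test class as soon as \<open>P(X)\<close> is integrable.\<close>

lemma characterizes_integral_cos:
  assumes "real_distribution \<nu>" "characterizes \<nu> M X m P \<alpha>" "\<alpha> \<noteq> 0" "u \<noteq> 0"
    and [measurable]: "X \<in> borel_measurable M" "P \<in> borel_measurable borel"
    and int: "integrable M (\<lambda>\<omega>. P (X \<omega>))"
  shows "(\<integral>x. cos (u * x + b) \<partial>\<nu>)
    = (\<integral>\<omega>. P (X \<omega>) * (cos (u * X \<omega> + (b - m * (pi / 2))) / u ^ m) \<partial>M) / \<alpha>"
proof -
  interpret real_distribution \<nu> by fact
  define F where "F = (\<lambda>x. inverse (u ^ m) * cos (u * x + (b - m * (pi / 2))))"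
  have Fm: "(deriv ^^ m) F = (\<lambda>x. cos (u * x + b))"
    using \<open>u \<noteq> 0\<close> unfolding F_def higher_deriv_cos by (simp add: algebra_simps)
  have "((deriv ^^ k) F) differentiable (at x)" for k x
    unfolding F_def higher_deriv_cos
    unfolding real_differentiable_def by (rule exI, (rule derivative_eq_intros refl)+)
  then have "F \<in> diff_class m"
    by (simp add: diff_class_def Fm)
  moreover have "integrable M (\<lambda>\<omega>. \<bar>P (X \<omega>) * F (X \<omega>)\<bar>)"
  proof (rule integrable_abs, rule Bochner_Integration.integrable_bound)
    show "integrable M (\<lambda>\<omega>. inverse (\<bar>u\<bar> ^ m) * P (X \<omega>))"
      using int by simp
    have "\<bar>F x\<bar> \<le> inverse (\<bar>u\<bar> ^ m)" for x
      unfolding F_def using mult_left_mono[OF abs_cos_le_one, of "inverse (\<bar>u\<bar> ^ m)"]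
      by (simp add: abs_mult power_abs)
    then show "AE \<omega> in M. norm (P (X \<omega>) * F (X \<omega>)) \<le> norm (inverse (\<bar>u\<bar> ^ m) * P (X \<omega>))"
      by (intro AE_I2) (simp add: abs_mult mult.commute[of "\<bar>P _\<bar>"] mult_right_mono)
    show "(\<lambda>\<omega>. P (X \<omega>) * F (X \<omega>)) \<in> borel_measurable M"
      unfolding F_def by measurable
  qed
  ultimately have "F \<in> test_class M X m P"
    by (simp add: test_class_def)
  moreover have "expectation_exists \<nu> ((deriv ^^ m) F)"
  proof -
    have "integrable \<nu> (\<lambda>x. cos (u * x + b))"
      by (intro integrable_const_bound[of _ 1]) auto
    then show ?thesis
      unfolding Fm expectation_exists_def by (auto simp: real_integrable_def less_top)
  qed
  ultimately have "(\<integral>\<omega>. P (X \<omega>) * F (X \<omega>) \<partial>M) = \<alpha> * (\<integral>x. (deriv ^^ m) F x \<partial>\<nu>)"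
    using assms(2) unfolding characterizes_def by blast
  then show ?thesis
    using \<open>\<alpha> \<noteq> 0\<close> unfolding Fm by (simp add: F_def field_simps)
qed

lemma char_eq_cos:
  assumes "real_distribution \<nu>"
  shows "char \<nu> u = Complex (\<integral>x. cos (u * x + 0) \<partial>\<nu>) (\<integral>x. cos (u * x + - (pi / 2)) \<partial>\<nu>)"
proof -
  interpret real_distribution \<nu> by fact
  have int: "integrable \<nu> (\<lambda>x. iexp (u * x))"
    by (intro integrable_const_bound[of _ 1]) auto
  have "Re (char \<nu> u) = (\<integral>x. Re (iexp (u * x)) \<partial>\<nu>)" "Im (char \<nu> u) = (\<integral>x. Im (iexp (u * x)) \<partial>\<nu>)"
    unfolding char_def using integral_Re[OF int] integral_Im[OF int] by simp_all
  then show ?thesis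
    by (intro complex_eqI) (simp_all add: Re_exp Im_exp cos_add cos_diff)
qed

text \<open>The right-hand side in \<open>characterizes_integral_cos\<close> does not mention the law. Frequency \<open>0\<close> is
  excluded there, but every characteristic function is \<open>1\<close> at \<open>0\<close>.\<close>

lemma characterizes_unique:
  assumes \<nu>: "real_distribution \<nu>" "characterizes \<nu> M X m P \<alpha>"
    and \<nu>': "real_distribution \<nu>'" "characterizes \<nu>' M X m P \<alpha>"
    and rest: "\<alpha> \<noteq> 0" "X \<in> borel_measurable M" "P \<in> borel_measurable borel"
      "integrable M (\<lambda>\<omega>. P (X \<omega>))"
  shows "\<nu> = \<nu>'"
proof (rule Levy_uniqueness[OF \<nu>(1) \<nu>'(1)], rule ext)
  fix u :: real
  show "char \<nu> u = char \<nu>' u"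
  proof (cases "u = 0")
    case True
    then show ?thesis
      using real_distribution.char_zero[OF \<nu>(1)] real_distribution.char_zero[OF \<nu>'(1)] by simp
  next
    case False
    then show ?thesis
      using characterizes_integral_cos[OF \<nu> rest(1) False rest(2-)]
        characterizes_integral_cos[OF \<nu>' rest(1) False rest(2-)]
      by (simp only: char_eq_cos[OF \<nu>(1)] char_eq_cos[OF \<nu>'(1)])
  qed
qed

section \<open>Existence and uniqueness\<close>

theorem theorem2p1:
  fixes M :: "'a measure" and X :: "'a \<Rightarrow> real" and m :: nat
    and P :: "real \<Rightarrow> real" and \<alpha> :: real
  assumes "prob_space M"
    and "X \<in> borel_measurable M"
    and "P \<in> borel_measurable borel"
    and "\<exists>I. sign_change_partition m P I \<and> positive_on P (I m)"
    and "\<And>k. k \<le> m \<Longrightarrow> integrable M (\<lambda>\<omega>. X \<omega> ^ k * P (X \<omega>))"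
    and "\<And>k. k \<le> m \<Longrightarrow>
           (1 / fact m) * (\<integral>\<omega>. X \<omega> ^ k * P (X \<omega>) \<partial>M) = \<alpha> * (if k = m then 1 else 0)"
    and "0 < \<alpha>"
  shows "\<exists>!\<nu>. real_distribution \<nu> \<and> characterizes \<nu> M X m P \<alpha>"
proof -
  obtain \<xi> where \<xi>: "strict_mono_on {..<m} \<xi>" "\<And>x. 0 \<le> P x * (\<Prod>i<m. x - \<xi> i)"
    using assms(4) sign_change_nodes by metis
  have moment: "(\<integral>\<omega>. X \<omega> ^ k * P (X \<omega>) \<partial>M) = \<alpha> * (if k = m then fact m else 0)" if "k \<le> m" for k
    using assms(6)[OF that] by (auto simp: field_simps)
  have int: "integrable M (\<lambda>\<omega>. P (X \<omega>))"
    using assms(5)[of 0] by simp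
  have "\<exists>\<nu>. real_distribution \<nu> \<and> characterizes \<nu> M X m P \<alpha>"
  proof (cases m)
    case 0
    then show ?thesis
      using \<xi>(2) moment[of 0] int assms(1-3,7) existence_no_sign_change[of M X P \<alpha>] by simp
  next
    case (Suc n)
    interpret prob_space M by fact
    interpret signed_moments M X P n \<xi> \<alpha>
    proof unfold_locales
      show "strict_mono_on {..n} \<xi>" "\<And>x. 0 \<le> P x * (\<Prod>i\<le>n. x - \<xi> i)"
        using \<xi> by (simp_all add: Suc lessThan_Suc_atMost)
      show "integrable M (\<lambda>\<omega>. X \<omega> ^ k * P (X \<omega>))" if "k \<le> Suc n" for k
        using assms(5)[of k] that by (simp add: Suc)
      show "(\<integral>\<omega>. X \<omega> ^ k * P (X \<omega>) \<partial>M) = 0" if "k \<le> n" for k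
        using moment[of k] that by (simp add: Suc)
      show "(\<integral>\<omega>. X \<omega> ^ Suc n * P (X \<omega>) \<partial>M) = \<alpha> * fact (Suc n)"
        using moment[of "Suc n"] unfolding Suc by (simp del: power_Suc fact_Suc)
    qed (use assms in simp_all)
    show ?thesis
      using real_distribution_law characterizes_law Suc by blast
  qed
  then show ?thesis
    using characterizes_unique[OF _ _ _ _ _ assms(2,3) int] assms(7) by blast
qed

end
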